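(* Let $n,k$ be integers with $1\le k\le n$. Then \[ \sigma(k)-\sigma(n)+\#([n]\cap[n-k]) \ge 0 \quad\text{and}\quad \sigma(k-1)-\sigma(n-1)+\#([n-1]\cap[n-k])\ge 0, \] i.e., the almost minimum zero estimate and the shifted almost minimum zero estimate for $\nu(S(n,k))$ are non-negative.
   Context: For a nonnegative integer $m$, $\sigma(m)$ is the sum of the base-$2$ digits of $m$ and $[m]$ is the set of powers of $2$ occurring in the base-$2$ expansion of $m$. For the Stirling number of the second kind $S(n,k)$ and $2$-adic valuation $\nu$, the almost minimum zero estimate is $\nu(S(n,k))\ge \sigma(k)-\sigma(n)+\#([n]\cap[n-k])$ and the shifted almost minimum zero estimate is $\nu(S(n,k))\ge \sigma(k-1)-\sigma(n-1)+\#([n-1]\cap[n-k])$. *)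

theory Defs
  imports Main
begin

text \<open>The \<^term>\<open>i\<close>-th base-2 digit of \<^term>\<open>m\<close> is \<^term>\<open>m div 2 ^ i mod 2\<close>; it vanishes for
  \<^term>\<open>i \<ge> m\<close> because \<^term>\<open>m < 2 ^ m\<close>, so the sum below ranges over all digits.\<close>

definition binary_digit_sum :: "nat \<Rightarrow> nat" where
  "binary_digit_sum m = (\<Sum>i<m. m div 2 ^ i mod 2)"

definition binary_powers :: "nat \<Rightarrow> nat set" where
  "binary_powers m = {2 ^ i | i. bit m i}"

end

theory Submission
  imports Defs
begin

text \<open>Both estimates are instances of \<open>\<sigma>(k + a) \<le> \<sigma>(k) + #([k + a] \<inter> [a])\<close> with \<open>a = n - k\<close>,
  for the pairs \<open>(n, k)\<close> and \<open>(n - 1, k - 1)\<close>. As \<open>#([m] \<inter> [a])\<close> is the digit sum of the bitwise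
  conjunction of \<open>m\<close> and \<open>a\<close>, this can be proved by adding \<open>k\<close> and \<open>a\<close> digit by digit; the
  induction has to carry along the companion bound for an incoming carry, namely
  \<open>\<sigma>(k + a + 1) \<le> \<sigma>(k) + 1 + #([k + a + 1] \<inter> [a])\<close>.\<close>

text \<open>Digits past the end vanish, so the range may be enlarged; this lets the digits of
  \<open>m\<close> and \<open>m div 2\<close> be matched term by term.\<close>

lemma binary_digit_sum_upto:
  assumes "m \<le> N"
  shows "binary_digit_sum m = (\<Sum>i<N. m div 2 ^ i mod 2)"
proof -
  have "m div 2 ^ i = 0" if "m \<le> i" for i
    using that less_exp[of i] by (intro div_less) linarith
  then show ?thesis
    unfolding binary_digit_sum_def
    using assms by (intro sum.mono_neutral_left) auto
qed

lemma binary_digit_sum_0 [simp]: "binary_digit_sum 0 = 0"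
  by (simp add: binary_digit_sum_def)

lemma binary_digit_sum_rec:
  "binary_digit_sum m = m mod 2 + binary_digit_sum (m div 2)"
proof -
  have "binary_digit_sum m = (\<Sum>i<Suc m. m div 2 ^ i mod 2)"
    by (intro binary_digit_sum_upto) simp
  also have "\<dots> = m mod 2 + (\<Sum>i<m. m div 2 div 2 ^ i mod 2)"
    by (simp add: sum.lessThan_Suc_shift div_mult2_eq del: sum.lessThan_Suc)
  also have "(\<Sum>i<m. m div 2 div 2 ^ i mod 2) = binary_digit_sum (m div 2)"
    by (intro binary_digit_sum_upto[symmetric]) simp
  finally show ?thesis .
qed

lemma binary_digit_sum_double [simp]: "binary_digit_sum (2 * m) = binary_digit_sum m"
  by (subst binary_digit_sum_rec) simp

lemma binary_digit_sum_Suc_double [simp]: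
  "binary_digit_sum (Suc (2 * m)) = Suc (binary_digit_sum m)"
  by (subst binary_digit_sum_rec) simp

text \<open>Distinct exponents give distinct powers of 2, so it suffices to count the odd quotients
  among the exponents below \<open>m\<close>.\<close>

lemma card_binary_powers: "card (binary_powers m) = binary_digit_sum m"
proof -
  have "i < m" if "bit m i" for i
  proof (rule ccontr)
    assume "\<not> i < m"
    then have "m < 2 ^ i"
      using less_exp[of i] by linarith
    with that show False
      by (simp add: bit_iff_odd)
  qed
  then have "binary_powers m = (\<lambda>i. 2 ^ i) ` {i \<in> {..<m}. odd (m div 2 ^ i)}"
    by (auto simp: binary_powers_def bit_iff_odd)
  then have "card (binary_powers m) = card {i \<in> {..<m}. odd (m div 2 ^ i)}"
    by (simp add: card_image inj_on_def)
  also have "\<dots> = (\<Sum>i<m. if odd (m div 2 ^ i) then 1 else 0)"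
    by (simp flip: sum.inter_filter)
  also have "\<dots> = binary_digit_sum m"
    unfolding binary_digit_sum_def by (intro sum.cong) (auto simp: odd_iff_mod_2_eq_one)
  finally show ?thesis .
qed

lemma binary_powers_and: "binary_powers (and m n) = binary_powers m \<inter> binary_powers n"
  by (auto simp: binary_powers_def bit_and_iff)

lemma and_double_nat:
  fixes m n :: nat
  shows "and (2 * m) (2 * n) = 2 * and m n"
    "and (2 * m) (Suc (2 * n)) = 2 * and m n"
    "and (Suc (2 * m)) (2 * n) = 2 * and m n"
    "and (Suc (2 * m)) (Suc (2 * n)) = Suc (2 * and m n)"
  by (subst and_rec; simp)+

lemma binary_digit_sum_add_le:
  "binary_digit_sum (k + a) \<le> binary_digit_sum k + binary_digit_sum (and (k + a) a)"
  "binary_digit_sum (Suc (k + a))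
    \<le> Suc (binary_digit_sum k + binary_digit_sum (and (Suc (k + a)) a))"
\<comment> \<open>Both numbers are halved at once; their sum drops strictly unless both are
  0.\<close>
proof (induction "k + a" arbitrary: k a rule: less_induct)
  case less
  have "binary_digit_sum (k + a) \<le> binary_digit_sum k + binary_digit_sum (and (k + a) a)
      \<and> binary_digit_sum (Suc (k + a))
        \<le> Suc (binary_digit_sum k + binary_digit_sum (and (Suc (k + a)) a))"
  proof (cases "k + a = 0")
    case True
    then show ?thesis
      using binary_digit_sum_Suc_double[of 0] by simp
  next
    case False
    define k' a' where "k' = k div 2" and "a' = a div 2"
    have IH: "binary_digit_sum (k' + a')
          \<le> binary_digit_sum k' + binary_digit_sum (and (k' + a') a')"
        "binary_digit_sum (Suc (k' + a'))
          \<le> Suc (binary_digit_sum k' + binary_digit_sum (and (Suc (k' + a')) a'))"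
      using less[of k' a'] False unfolding k'_def a'_def by linarith+
    have k: "k = 2 * k' \<or> k = Suc (2 * k')" and a: "a = 2 * a' \<or> a = Suc (2 * a')"
      unfolding k'_def a'_def by linarith+
    \<comment> \<open>The second equation passes a carry on to the next digit.\<close>
    have sums: "2 * k' + 2 * a' = 2 * (k' + a')"
        "Suc (Suc (2 * (k' + a'))) = 2 * Suc (k' + a')"
      by simp_all
    \<comment> \<open>A carry leaves the lowest digit when at least two of the two digits and the
      incoming carry are 1. The second part of \<open>IH\<close> then applies, otherwise the
      first.\<close>
    from k a show ?thesis
      by (elim disjE)
        (intro conjI; simp only: add_Suc add_Suc_right sums and_double_nat
          binary_digit_sum_double binary_digit_sum_Suc_double; insert IH; linarith)+
  qed
  then show
    "binary_digit_sum (k + a) \<le> binary_digit_sum k + binary_digit_sum (and (k + a) a)"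
    "binary_digit_sum (Suc (k + a))
      \<le> Suc (binary_digit_sum k + binary_digit_sum (and (Suc (k + a)) a))"
    by blast+
qed

lemma binary_digit_sum_le_diff:
  assumes "k \<le> n"
  shows "binary_digit_sum n
    \<le> binary_digit_sum k + card (binary_powers n \<inter> binary_powers (n - k))"
  using binary_digit_sum_add_le(1)[of k "n - k"] assms
  by (simp add: card_binary_powers flip: binary_powers_and)

theorem theorem3p1:
  fixes n k :: nat
  assumes "1 \<le> k" and "k \<le> n"
  shows "int (binary_digit_sum k) - int (binary_digit_sum n)
           + int (card (binary_powers n \<inter> binary_powers (n - k))) \<ge> 0
       \<and> int (binary_digit_sum (k - 1)) - int (binary_digit_sum (n - 1))
           + int (card (binary_powers (n - 1) \<inter> binary_powers (n - k))) \<ge> 0"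
proof -
  \<comment> \<open>As \<open>1 \<le> k\<close>, truncated subtraction is harmless and the shift
    keeps the summand \<open>a\<close> unchanged.\<close>
  have "n - 1 - (k - 1) = n - k"
    using assms by simp
  then show ?thesis
    using binary_digit_sum_le_diff[of k n] binary_digit_sum_le_diff[of "k - 1" "n - 1"] assms
    by (simp add: diff_le_mono)
qed

end
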